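(* Every graph with diameter two has a terminal set.
   Context: All graphs are simple and undirected. A set $S \subseteq V(G)$ is in general position if no shortest path of $G$ contains three vertices of $S$. A terminal set of $G$ is a general position set $S$ that is maximal under inclusion and such that for every vertex $u \in V(G)\setminus S$ there is a shortest path of $G$ with $u$ as an endpoint that contains at least two vertices of $S$. *)

theory Defs
  imports "Graph_Theory.Graph_Theory"
begin

text \<open>
  Undirected graphs are symmetric digraphs, as in the library locale \<^locale>\<open>graph\<close>, but
  neither the vertex set nor the arc set is required to be finite.
\<close>
locale simple_graph = loopfree_digraph + nomulti_digraph + sym_digraph

context wf_digraph
begin

definition graph_dist :: "'a \<Rightarrow> 'a \<Rightarrow> ereal" where
  "graph_dist u v = \<mu> (\<lambda>_. 1) u v"

text \<open>
  Vertices in different components have distance \<open>\<infinity>\<close>, so a graph of finite diameter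
  is connected.
\<close>
definition graph_diameter :: ereal where
  "graph_diameter = (SUP (u, v) \<in> verts G \<times> verts G. graph_dist u v)"

definition shortest_path :: "'a \<Rightarrow> 'b awalk \<Rightarrow> 'a \<Rightarrow> bool" where
  "shortest_path u p v \<longleftrightarrow> apath u p v \<and> ereal (real (length p)) = graph_dist u v"

definition general_position :: "'a set \<Rightarrow> bool" where
  "general_position S \<longleftrightarrow> S \<subseteq> verts G \<and>
     \<not> (\<exists>u p v. shortest_path u p v \<and> 3 \<le> card (S \<inter> set (awalk_verts u p)))"

text \<open>
  In a symmetric digraph the reverse of a shortest path is a shortest path on the same vertices,
  so a path with \<open>u\<close> as an endpoint may be taken to start in \<open>u\<close>.
\<close>
definition terminal_set :: "'a set \<Rightarrow> bool" where
  "terminal_set S \<longleftrightarrow> general_position S \<and>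
     (\<forall>T. general_position T \<and> S \<subseteq> T \<longrightarrow> T = S) \<and>
     (\<forall>u \<in> verts G - S. \<exists>p v. shortest_path u p v \<and> 2 \<le> card (S \<inter> set (awalk_verts u p)))"

end

end

theory Submission
  imports Defs
begin

text \<open>
  In a graph of diameter two, a shortest path with three vertices is an induced \<open>P\<^sub>3\<close> and no
  shortest path is longer, so a set is in general position iff it contains no induced \<open>P\<^sub>3\<close>,
  i.e. iff it induces a disjoint union of cliques. Such a set is terminal if every vertex outside
  it is an end of an induced \<open>P\<^sub>3\<close> whose other two vertices are in the set.
  Collect cliques greedily: given the cliques chosen so far, add a maximal clique of the subgraph
  induced by the vertices that have no neighbour among them. A vertex \<open>u\<close> left out at the end
  has a neighbour in some chosen clique; in the first such clique it also has a non-neighbour,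
  because that clique was maximal in a subgraph containing \<open>u\<close>.
  The invariant \<open>locally_terminal\<close> passes to unions of chains, so Zorn's lemma
  replaces the transfinite iteration when the graph is infinite.
\<close>

lemma exists_maximal_pairwise:
  assumes "symp R"
  obtains K where "K \<subseteq> U" "pairwise R K" "\<And>u. u \<in> U - K \<Longrightarrow> \<exists>b\<in>K. \<not> R u b"
proof -
  let ?A = "{K. K \<subseteq> U \<and> pairwise R K}"
  have "\<exists>K\<in>?A. \<forall>X\<in>?A. K \<subseteq> X \<longrightarrow> X = K"
  proof (rule subset_Zorn')
    fix C assume C: "subset.chain ?A C"
    then have "pairwise R (\<Union>C)"
      by (intro pairwise_chain_Union) (auto simp: subset_chain_def chain_subset_def)
    then show "\<Union>C \<in> ?A" using C by (auto simp: subset_chain_def)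
  qed
  then obtain K where K: "K \<subseteq> U" "pairwise R K"
    and maximal: "\<And>X. X \<subseteq> U \<Longrightarrow> pairwise R X \<Longrightarrow> K \<subseteq> X \<Longrightarrow> X = K"
    by (metis (mono_tags, lifting) mem_Collect_eq)
  have "\<exists>b\<in>K. \<not> R u b" if u: "u \<in> U - K" for u
  proof (rule ccontr)
    assume "\<not> (\<exists>b\<in>K. \<not> R u b)"
    then have "pairwise R (insert u K)"
      using K(2) sympD[OF assms] by (auto simp: pairwise_insert)
    then have "insert u K = K" using K(1) u by (intro maximal) auto
    then show False using u by blast
  qed
  then show thesis using that K by blast
qed

context pre_digraph
begin

abbreviation clique :: "'a set \<Rightarrow> bool" where
  "clique K \<equiv> pairwise (dominates G) K"

definition induced_P3 :: "'a \<Rightarrow> 'a \<Rightarrow> 'a \<Rightarrow> bool" where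
  "induced_P3 u a b \<longleftrightarrow> u \<rightarrow> a \<and> a \<rightarrow> b \<and> u \<noteq> b \<and> \<not> u \<rightarrow> b"

definition induced_P3_free :: "'a set \<Rightarrow> bool" where
  "induced_P3_free S \<longleftrightarrow> (\<forall>u\<in>S. \<forall>a\<in>S. \<forall>b\<in>S. \<not> induced_P3 u a b)"

definition ends_induced_P3 :: "'a set \<Rightarrow> 'a \<Rightarrow> bool" where
  "ends_induced_P3 S u \<longleftrightarrow> (\<exists>a\<in>S. \<exists>b\<in>S. induced_P3 u a b)"

definition locally_terminal :: "'a set \<Rightarrow> bool" where
  "locally_terminal S \<longleftrightarrow> S \<subseteq> verts G \<and> induced_P3_free S \<and>
     (\<forall>u \<in> verts G - S. (\<exists>a\<in>S. u \<rightarrow> a) \<longrightarrow> ends_induced_P3 S u)"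

lemma induced_P3_distinct: "induced_P3 u a b \<Longrightarrow> distinct [u, a, b]"
  by (auto simp: induced_P3_def)

lemma clique_imp_induced_P3_free: "clique K \<Longrightarrow> induced_P3_free K"
  by (auto simp: induced_P3_free_def induced_P3_def pairwise_def)

lemma ends_induced_P3_mono: "ends_induced_P3 S u \<Longrightarrow> S \<subseteq> T \<Longrightarrow> ends_induced_P3 T u"
  by (auto simp: ends_induced_P3_def)

lemma ends_induced_P3_if_clique:
  assumes "clique K" "a \<in> K" "b \<in> K" "u \<notin> K" "u \<rightarrow> a" "\<not> u \<rightarrow> b"
  shows "ends_induced_P3 K u"
proof -
  have "a \<rightarrow> b" using assms by (metis pairwiseD)
  then have "induced_P3 u a b" using assms by (auto simp: induced_P3_def)
  then show ?thesis using assms(2,3) by (auto simp: ends_induced_P3_def)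
qed

lemma induced_P3_free_Union_chain:
  assumes chain: "subset.chain \<A> C" and free: "\<And>S. S \<in> C \<Longrightarrow> induced_P3_free S"
  shows "induced_P3_free (\<Union>C)"
  unfolding induced_P3_free_def
proof (intro ballI)
  fix u a b assume "u \<in> \<Union>C" "a \<in> \<Union>C" "b \<in> \<Union>C"
  then obtain S where "S \<in> C" "{u, a, b} \<subseteq> S"
    using finite_subset_Union_chain[of "{u, a, b}" C \<A>] chain by blast
  then show "\<not> induced_P3 u a b" using free by (auto simp: induced_P3_free_def)
qed

lemma locally_terminal_Union_chain:
  assumes chain: "subset.chain (Collect locally_terminal) C"
  shows "locally_terminal (\<Union>C)"
proof -
  have terminal: "locally_terminal S" if "S \<in> C" for S
    using chain that by (auto simp: subset_chain_def)
  have "ends_induced_P3 (\<Union>C) u"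
    if "u \<in> verts G - \<Union>C" "a \<in> S" "S \<in> C" "u \<rightarrow> a" for u a S
  proof -
    have "ends_induced_P3 S u" using terminal that unfolding locally_terminal_def by blast
    then show ?thesis using \<open>S \<in> C\<close> by (blast intro: ends_induced_P3_mono)
  qed
  moreover have "induced_P3_free (\<Union>C)"
    using chain terminal by (auto simp: locally_terminal_def intro: induced_P3_free_Union_chain)
  ultimately show ?thesis using terminal unfolding locally_terminal_def by blast
qed

end

context sym_digraph
begin

lemma induced_P3_free_Un:
  assumes "induced_P3_free S" "induced_P3_free T"
    and "\<And>x y. x \<in> S \<Longrightarrow> y \<in> T \<Longrightarrow> \<not> y \<rightarrow> x"
  shows "induced_P3_free (S \<union> T)"
proof -
  have "\<not> x \<rightarrow> y" if "x \<in> S" "y \<in> T" for x y using assms(3) that graph_symmetric by blast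
  then show ?thesis using assms unfolding induced_P3_free_def induced_P3_def by blast
qed

lemma locally_terminal_extend:
  assumes S: "locally_terminal S" and v: "v \<in> verts G - S" "\<And>a. a \<in> S \<Longrightarrow> \<not> v \<rightarrow> a"
  obtains T where "locally_terminal T" "S \<subset> T"
proof -
  define U where "U = {u \<in> verts G - S. \<forall>a\<in>S. \<not> u \<rightarrow> a}"
  have "symp (dominates G)" by (auto intro: sympI graph_symmetric)
  then obtain K where K: "K \<subseteq> U" "clique K"
    and maximal: "\<And>u. u \<in> U - K \<Longrightarrow> \<exists>b\<in>K. \<not> u \<rightarrow> b"
    using exists_maximal_pairwise[of "dominates G" U] by metis
  have "v \<in> U" using v by (simp add: U_def)
  then have "K \<noteq> {}" using maximal by blast
  have "ends_induced_P3 (S \<union> K) u"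
    if u: "u \<in> verts G - (S \<union> K)" and a: "a \<in> S \<union> K" "u \<rightarrow> a" for u a
  proof (cases "u \<in> U")
    case True
    then have "a \<in> K" using a by (auto simp: U_def)
    obtain b where "b \<in> K" "\<not> u \<rightarrow> b" using maximal True u by blast
    then have "ends_induced_P3 K u"
      using ends_induced_P3_if_clique[OF K(2) \<open>a \<in> K\<close>] u a(2) by blast
    then show ?thesis by (auto intro: ends_induced_P3_mono)
  next
    case False
    then have "ends_induced_P3 S u" using S u unfolding U_def locally_terminal_def by blast
    then show ?thesis by (auto intro: ends_induced_P3_mono)
  qed
  moreover have "induced_P3_free (S \<union> K)"
    using S K clique_imp_induced_P3_free
    by (intro induced_P3_free_Un) (auto simp: U_def locally_terminal_def)
  moreover have "S \<union> K \<subseteq> verts G" using S K(1) by (auto simp: U_def locally_terminal_def)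
  ultimately have "locally_terminal (S \<union> K)" unfolding locally_terminal_def by blast
  moreover have "S \<subset> S \<union> K" using K(1) \<open>K \<noteq> {}\<close> by (auto simp: U_def)
  ultimately show thesis by (rule that)
qed

lemma exists_induced_P3_free_ends_induced_P3:
  obtains S where "S \<subseteq> verts G" "induced_P3_free S"
    "\<And>u. u \<in> verts G - S \<Longrightarrow> ends_induced_P3 S u"
proof -
  have "\<exists>S\<in>Collect locally_terminal. \<forall>X\<in>Collect locally_terminal. S \<subseteq> X \<longrightarrow> X = S"
    by (rule subset_Zorn') (simp add: locally_terminal_Union_chain)
  then obtain S where S: "locally_terminal S"
    and maximal: "\<And>X. locally_terminal X \<Longrightarrow> S \<subseteq> X \<Longrightarrow> X = S" by blast
  have "ends_induced_P3 S u" if u: "u \<in> verts G - S" for u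
  proof -
    have "\<exists>a\<in>S. u \<rightarrow> a" using locally_terminal_extend[OF S u] maximal by blast
    then show ?thesis using S u unfolding locally_terminal_def by blast
  qed
  then show thesis using that S unfolding locally_terminal_def by blast
qed

end

context wf_digraph
begin

lemma graph_dist_eq_INF_length:
  "graph_dist u v = (INF p\<in>{p. awalk u p v}. ereal (real (length p)))"
  by (simp add: graph_dist_def \<mu>_def awalk_cost_def sum_list_triv)

lemma graph_dist_le_length: "awalk u p v \<Longrightarrow> graph_dist u v \<le> ereal (real (length p))"
  by (auto simp: graph_dist_eq_INF_length intro: INF_lower)

lemma graph_dist_le_diameter:
  "u \<in> verts G \<Longrightarrow> v \<in> verts G \<Longrightarrow> graph_dist u v \<le> graph_diameter"
  unfolding graph_diameter_def by (rule SUP_upper2[of "(u, v)"]) auto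

lemma graph_dist_ge_2_iff:
  assumes "u \<noteq> v"
  shows "2 \<le> graph_dist u v \<longleftrightarrow> \<not> u \<rightarrow> v"
proof
  assume far: "2 \<le> graph_dist u v"
  show "\<not> u \<rightarrow> v"
  proof
    assume "u \<rightarrow> v"
    then obtain e where "awalk u [e] v" by (auto dest: arc_implies_awalk)
    then have "graph_dist u v \<le> ereal 1" using graph_dist_le_length[of u "[e]" v] by simp
    with far have "2 \<le> ereal 1" by (rule order_trans)
    then show False by simp
  qed
next
  assume nonadjacent: "\<not> u \<rightarrow> v"
  have "2 \<le> length p" if walk: "awalk u p v" for p
  proof -
    have "p \<noteq> []" using walk assms by (auto simp: awalk_simps)
    moreover have "p \<noteq> [e]" for e
      using walk nonadjacent by (auto simp: awalk_simps dest: in_arcs_imp_in_arcs_ends)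
    ultimately show ?thesis by (cases p; cases "tl p") auto
  qed
  then show "2 \<le> graph_dist u v"
    by (auto simp: graph_dist_eq_INF_length intro!: INF_greatest)
qed

lemma induced_P3_iff_shortest_path:
  "induced_P3 u a b \<longleftrightarrow> (\<exists>p. shortest_path u p b \<and> awalk_verts u p = [u, a, b])"
proof
  assume P3: "induced_P3 u a b"
  then obtain e f where "e \<in> arcs G" "tail G e = u" "head G e = a"
    and "f \<in> arcs G" "tail G f = a" "head G f = b"
    by (metis induced_P3_def reachableE)
  then have walk: "awalk u [e, f] b" and verts: "awalk_verts u [e, f] = [u, a, b]"
    by (auto simp: awalk_simps)
  have "graph_dist u b = 2"
    using P3 graph_dist_ge_2_iff[of u b] graph_dist_le_length[OF walk]
    by (auto simp: induced_P3_def)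
  then have "shortest_path u [e, f] b"
    using walk verts induced_P3_distinct[OF P3] by (simp add: shortest_path_def apath_def)
  then show "\<exists>p. shortest_path u p b \<and> awalk_verts u p = [u, a, b]" using verts by blast
next
  assume "\<exists>p. shortest_path u p b \<and> awalk_verts u p = [u, a, b]"
  then obtain p where p: "shortest_path u p b" and verts: "awalk_verts u p = [u, a, b]" by blast
  have "length p = 2" using verts length_awalk_verts[of u p] by simp
  then have "graph_dist u b = 2" using p by (simp add: shortest_path_def)
  moreover have "u \<noteq> b" using p verts by (simp add: shortest_path_def apath_def)
  moreover obtain e f where "p = [e, f]"
    using \<open>length p = 2\<close> by (auto simp: length_Suc_conv numeral_2_eq_2)
  then have "u \<rightarrow> a" "a \<rightarrow> b"
    using p verts
    by (auto simp: shortest_path_def apath_def awalk_simps dest: in_arcs_imp_in_arcs_ends)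
  ultimately show "induced_P3 u a b"
    using graph_dist_ge_2_iff[of u b] by (simp add: induced_P3_def)
qed

lemma general_position_imp_induced_P3_free:
  assumes "general_position S"
  shows "induced_P3_free S"
  unfolding induced_P3_free_def
proof (intro ballI notI)
  fix u a b assume S: "u \<in> S" "a \<in> S" "b \<in> S" and P3: "induced_P3 u a b"
  obtain p where p: "shortest_path u p b" "awalk_verts u p = [u, a, b]"
    using P3 induced_P3_iff_shortest_path by blast
  have "S \<inter> set (awalk_verts u p) = set [u, a, b]" using S p(2) by auto
  then have "card (S \<inter> set (awalk_verts u p)) = 3"
    using distinct_card[OF induced_P3_distinct[OF P3]] by simp
  then have "3 \<le> card (S \<inter> set (awalk_verts u p))" by simp
  then show False using assms p(1) unfolding general_position_def by blast
qed

lemma shortest_path_length_le_2: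
  assumes "graph_diameter \<le> 2" "shortest_path u p v"
  shows "length p \<le> 2"
proof -
  have "awalk u p v" using assms(2) by (simp add: shortest_path_def apath_def)
  then have "ereal (real (length p)) \<le> 2"
    using assms graph_dist_le_diameter[of u v]
    by (auto simp: shortest_path_def dest: awalk_hd_in_verts awalk_last_in_verts)
  then show ?thesis by simp
qed

lemma induced_P3_free_imp_general_position:
  assumes diameter: "graph_diameter \<le> 2" and S: "S \<subseteq> verts G" "induced_P3_free S"
  shows "general_position S"
  unfolding general_position_def
proof (intro conjI notI S(1))
  assume "\<exists>u p v. shortest_path u p v \<and> 3 \<le> card (S \<inter> set (awalk_verts u p))"
  then obtain u p v where p: "shortest_path u p v"
    and card: "3 \<le> card (S \<inter> set (awalk_verts u p))" by blast
  let ?vs = "awalk_verts u p"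
  have "length ?vs \<le> 3"
    using shortest_path_length_le_2[OF diameter p] by (simp add: length_awalk_verts)
  then have "card (set ?vs) \<le> 3" using card_length order_trans by blast
  then have "S \<inter> set ?vs = set ?vs" using card by (intro card_seteq) auto
  then have "set ?vs \<subseteq> S" and "3 \<le> length ?vs"
    using card card_length[of ?vs] by auto
  with \<open>length ?vs \<le> 3\<close> have "length ?vs = 3" by simp
  then obtain x a y where "?vs = [x, a, y]"
    by (auto simp: length_Suc_conv numeral_3_eq_3)
  moreover have "hd ?vs = u" "last ?vs = v"
    using p by (auto simp: shortest_path_def apath_def)
  ultimately have vs: "?vs = [u, a, v]" by simp
  then have "induced_P3 u a v" using p induced_P3_iff_shortest_path by blast
  then show False using S(2) \<open>set ?vs \<subseteq> S\<close> vs by (simp add: induced_P3_free_def)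
qed

lemma terminal_setI_induced_P3:
  assumes general: "general_position S"
    and ends: "\<And>u. u \<in> verts G - S \<Longrightarrow> ends_induced_P3 S u"
  shows "terminal_set S"
proof -
  have "T = S" if T: "general_position T" "S \<subseteq> T" for T
  proof (rule ccontr)
    assume "T \<noteq> S"
    then obtain u where u: "u \<in> T" "u \<in> verts G - S"
      using T unfolding general_position_def by blast
    then have "ends_induced_P3 T u" using ends T(2) by (blast intro: ends_induced_P3_mono)
    then show False
      using general_position_imp_induced_P3_free[OF T(1)] u(1)
      by (auto simp: induced_P3_free_def ends_induced_P3_def)
  qed
  moreover have "\<exists>p v. shortest_path u p v \<and> 2 \<le> card (S \<inter> set (awalk_verts u p))"
    if u: "u \<in> verts G - S" for u
  proof -
    obtain a b where ab: "a \<in> S" "b \<in> S" and P3: "induced_P3 u a b"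
      using ends[OF u] unfolding ends_induced_P3_def by blast
    obtain p where p: "shortest_path u p b" "awalk_verts u p = [u, a, b]"
      using P3 induced_P3_iff_shortest_path by blast
    have "S \<inter> set (awalk_verts u p) = {a, b}" using p(2) ab u by auto
    then have "card (S \<inter> set (awalk_verts u p)) = 2"
      using induced_P3_distinct[OF P3] by simp
    then show ?thesis using p(1) by (metis order_refl)
  qed
  ultimately show ?thesis using general unfolding terminal_set_def by blast
qed

end

theorem (in sym_digraph) exists_terminal_set:
  assumes "graph_diameter \<le> 2"
  obtains S where "terminal_set S"
proof -
  obtain S where S: "S \<subseteq> verts G" "induced_P3_free S"
    and ends: "\<And>u. u \<in> verts G - S \<Longrightarrow> ends_induced_P3 S u"
    using exists_induced_P3_free_ends_induced_P3 by blast
  have "general_position S" using assms S by (rule induced_P3_free_imp_general_position)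
  then have "terminal_set S" using ends by (rule terminal_setI_induced_P3)
  then show thesis by (rule that)
qed

theorem theorem3p1:
  fixes G :: "('a, 'b) pre_digraph"
  assumes "simple_graph G"
    and "wf_digraph.graph_diameter G = 2"
  shows "\<exists>S. wf_digraph.terminal_set G S"
proof -
  interpret simple_graph G by fact
  have "graph_diameter \<le> 2" using assms(2) by simp
  then show ?thesis using exists_terminal_set by blast
qed

end
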